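(* Let $G$ be a locally compact abelian group, let $n\in\mathbb{Z}_+$ and let $\varphi\in C(G)$. The following are equivalent: (a) $\varphi$ is a polynomial of degree $n$, i.e. $\Delta_{y_1}\cdots\Delta_{y_{n+1}}\varphi=0$ for all $y_1,\dots,y_{n+1}\in G$ and $\Delta_{y_1}\cdots\Delta_{y_n}\varphi\neq 0$ for some $y_1,\dots,y_n\in G$. (b) $\Delta_y^{n+1}\varphi=0$ for all $y\in G$ and $\Delta_y^{n}\varphi\neq 0$ for some $y\in G$. (c) $\varphi$ is a polynomial of degree $n$ in the sense of Domar, i.e. $\varphi(x+ty)$ is a polynomial in $t\in\mathbb{Z}_+$ of degree at most $n$ for all $x,y\in G$, and of degree $n$ for some $x,y\in G$. (d) $\varphi(x+t_1y_1+\dots+t_ky_k)$ is a polynomial in $(t_1,\dots,t_k)\in\mathbb{Z}_+^k$ of degree at most $n$ for all $x,y_1,\dots,y_k\in G$ and all $k>0$, and of degree $n$ for some $x,y_1,\dots,y_k\in G$ and some $k>0$.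
   Context: $G$ is written additively. $C(G)$ is the space of continuous functions $G\to\mathbb{C}$. $\mathbb{Z}_+$ is the semigroup of non-negative integers and $\mathbb{Z}_+^k=(\mathbb{Z}_+)^k$. For $\varphi:G\to\mathbb{C}$ and $y\in G$, $\Delta_y\varphi(x)=\varphi(x+y)-\varphi(x)$, and $\Delta_y^m$ is the $m$-fold iterate of $\Delta_y$ (with $\Delta_y^0\varphi=\varphi$; an empty product of difference operators is the identity). In (c) and (d) "polynomial in $t$" means an ordinary polynomial with complex coefficients, and degree in (d) means total degree. *)

theory Defs
  imports
    "HOL-Analysis.Analysis"
    "HOL-Computational_Algebra.Polynomial"
    "HOL-Library.Poly_Mapping"
begin

definition Delta :: "'a::ab_group_add \<Rightarrow> ('a \<Rightarrow> complex) \<Rightarrow> 'a \<Rightarrow> complex" where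
  "Delta y \<phi> = (\<lambda>x. \<phi> (x + y) - \<phi> x)"

definition Deltas :: "'a::ab_group_add list \<Rightarrow> ('a \<Rightarrow> complex) \<Rightarrow> 'a \<Rightarrow> complex" where
  "Deltas ys \<phi> = foldr Delta ys \<phi>"

definition nmult :: "nat \<Rightarrow> 'a::ab_group_add \<Rightarrow> 'a" where
  "nmult t y = ((+) y ^^ t) 0"

text \<open>
  Zero polynomials: the zero function has degree at most every \<open>n\<close>, but it does not have
  degree \<open>n\<close> for any natural number \<open>n\<close>, in particular not degree \<open>0\<close>. As \<open>degree 0 = 0\<close> in the
  library, the exact-degree predicate below needs \<open>p \<noteq> 0\<close>.
\<close>

definition poly_fun_deg_le :: "nat \<Rightarrow> (nat \<Rightarrow> complex) \<Rightarrow> bool" where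
  "poly_fun_deg_le n f \<longleftrightarrow>
     (\<exists>p :: complex poly. Polynomial.degree p \<le> n \<and> (\<forall>t. f t = poly p (of_nat t)))"

definition poly_fun_deg :: "nat \<Rightarrow> (nat \<Rightarrow> complex) \<Rightarrow> bool" where
  "poly_fun_deg n f \<longleftrightarrow>
     (\<exists>p :: complex poly. p \<noteq> 0 \<and> Polynomial.degree p = n \<and> (\<forall>t. f t = poly p (of_nat t)))"

text \<open>
  Multivariate polynomials over \<open>\<complex>\<close> are finitely supported maps from exponent vectors to
  coefficients; \<open>mpoly_in k p\<close> says that only the variables with index \<open>< k\<close> occur. A point
  \<open>(t\<^sub>1, \<dots>, t\<^sub>k)\<close> is given by a function on indices, of which only the values at
  \<open>0, \<dots>, k - 1\<close> are used.
\<close>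

type_synonym mpoly = "(nat \<Rightarrow>\<^sub>0 nat) \<Rightarrow>\<^sub>0 complex"

definition mpoly_in :: "nat \<Rightarrow> mpoly \<Rightarrow> bool" where
  "mpoly_in k p \<longleftrightarrow> (\<forall>m \<in> Poly_Mapping.keys p. Poly_Mapping.keys m \<subseteq> {..<k})"

definition mpoly_eval :: "mpoly \<Rightarrow> (nat \<Rightarrow> complex) \<Rightarrow> complex" where
  "mpoly_eval p z =
     (\<Sum>m \<in> Poly_Mapping.keys p. Poly_Mapping.lookup p m *
        (\<Prod>i \<in> Poly_Mapping.keys m. z i ^ Poly_Mapping.lookup m i))"

definition monom_deg :: "(nat \<Rightarrow>\<^sub>0 nat) \<Rightarrow> nat" where
  "monom_deg m = (\<Sum>i \<in> Poly_Mapping.keys m. Poly_Mapping.lookup m i)"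

definition total_degree :: "mpoly \<Rightarrow> nat" where
  "total_degree p = Max (insert 0 (monom_deg ` Poly_Mapping.keys p))"

definition mpoly_fun_deg_le :: "nat \<Rightarrow> nat \<Rightarrow> ((nat \<Rightarrow> nat) \<Rightarrow> complex) \<Rightarrow> bool" where
  "mpoly_fun_deg_le k n f \<longleftrightarrow>
     (\<exists>p. mpoly_in k p \<and> total_degree p \<le> n \<and> (\<forall>t. f t = mpoly_eval p (\<lambda>i. of_nat (t i))))"

definition mpoly_fun_deg :: "nat \<Rightarrow> nat \<Rightarrow> ((nat \<Rightarrow> nat) \<Rightarrow> complex) \<Rightarrow> bool" where
  "mpoly_fun_deg k n f \<longleftrightarrow>
     (\<exists>p. mpoly_in k p \<and> p \<noteq> 0 \<and> total_degree p = n \<and>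
        (\<forall>t. f t = mpoly_eval p (\<lambda>i. of_nat (t i))))"

definition is_polynomial :: "nat \<Rightarrow> ('a::ab_group_add \<Rightarrow> complex) \<Rightarrow> bool" where
  "is_polynomial n \<phi> \<longleftrightarrow>
     (\<forall>ys. length ys = n + 1 \<longrightarrow> Deltas ys \<phi> = (\<lambda>_. 0)) \<and>
     (\<exists>ys. length ys = n \<and> Deltas ys \<phi> \<noteq> (\<lambda>_. 0))"

definition is_Domar_polynomial :: "nat \<Rightarrow> ('a::ab_group_add \<Rightarrow> complex) \<Rightarrow> bool" where
  "is_Domar_polynomial n \<phi> \<longleftrightarrow>
     (\<forall>x y. poly_fun_deg_le n (\<lambda>t. \<phi> (x + nmult t y))) \<and>
     (\<exists>x y. poly_fun_deg n (\<lambda>t. \<phi> (x + nmult t y)))"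

definition is_polynomial_diag :: "nat \<Rightarrow> ('a::ab_group_add \<Rightarrow> complex) \<Rightarrow> bool" where
  "is_polynomial_diag n \<phi> \<longleftrightarrow>
     (\<forall>y. (Delta y ^^ (n + 1)) \<phi> = (\<lambda>_. 0)) \<and>
     (\<exists>y. (Delta y ^^ n) \<phi> \<noteq> (\<lambda>_. 0))"

definition is_multi_Domar_polynomial :: "nat \<Rightarrow> ('a::ab_group_add \<Rightarrow> complex) \<Rightarrow> bool" where
  "is_multi_Domar_polynomial n \<phi> \<longleftrightarrow>
     (\<forall>k>0. \<forall>x. \<forall>y :: nat \<Rightarrow> 'a.
        mpoly_fun_deg_le k n (\<lambda>t. \<phi> (x + (\<Sum>i<k. nmult (t i) (y i))))) \<and>
     (\<exists>k>0. \<exists>x. \<exists>y :: nat \<Rightarrow> 'a.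
        mpoly_fun_deg k n (\<lambda>t. \<phi> (x + (\<Sum>i<k. nmult (t i) (y i)))))"

end

theory Submission
  imports Defs
begin

text \<open>
  Each exact-degree condition says that a vanishing condition holds at level \<open>n + 1\<close> and fails at
  level \<open>n\<close>, so it suffices to compare the vanishing conditions. The crucial implication
  is from \<open>\<Delta>\<^sub>w\<^sup>m \<phi> = 0\<close> for all \<open>w\<close> to \<open>\<Delta>\<^sub>y \<Delta>\<^sub>z\<^sup>m\<^sup>-\<^sup>1 \<phi> = 0\<close>, which gives the
  mixed differences by induction on \<open>m\<close>. Division of group elements is not available; instead
  one shows \<open>\<Delta>\<^sub>y\<^sup>i \<Delta>\<^sub>z\<^sup>j \<phi> = 0\<close> for \<open>i + j \<ge> d\<close> by descending induction on \<open>d\<close>, from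
  \<open>d = 2 m\<close> to \<open>d = m\<close>: modulo differences of higher order, the operator
  \<open>\<Delta>\<^bsub>y + t z\<^esub>\<close> equals \<open>\<Delta>\<^sub>y + t \<Delta>\<^sub>z\<close>, whose \<open>m\<close>-th power is a polynomial in \<open>t\<close>
  that vanishes at all natural numbers. Vanishing mixed differences give polynomials in several
  variables by Newton interpolation in one variable at a time.
\<close>

section \<open>Difference operators\<close>

lemma Delta_apply: "Delta y f x = f (x + y) - f x"
  by (simp add: Delta_def)

lemma Delta_commute: "Delta y (Delta z f) = Delta z (Delta y f)"
  by (rule ext) (simp add: Delta_apply algebra_simps)

lemma Delta_funpow_commute1: "Delta y ((Delta z ^^ j) f) = (Delta z ^^ j) (Delta y f)"
  by (induction j) (simp_all, metis Delta_commute)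

lemma Delta_funpow_commute: "(Delta y ^^ i) ((Delta z ^^ j) f) = (Delta z ^^ j) ((Delta y ^^ i) f)"
  by (induction i) (simp_all add: Delta_funpow_commute1)

lemma Delta_zero [simp]: "Delta y (\<lambda>_. 0) = (\<lambda>_. 0)"
  by (simp add: Delta_def)

lemma Delta_funpow_zero [simp]: "(Delta y ^^ i) (\<lambda>_. 0) = (\<lambda>_. 0)"
  by (induction i) simp_all

lemma Delta_add: "Delta y (\<lambda>x. f x + g x) = (\<lambda>x. Delta y f x + Delta y g x)"
  by (simp add: Delta_def algebra_simps)

lemma Delta_scale: "Delta y (\<lambda>x. c * f x) = (\<lambda>x. c * Delta y f x)"
  by (simp add: Delta_def algebra_simps)

lemma Delta_shift: "Delta y (\<lambda>x. f (x + w)) = (\<lambda>x. Delta y f (x + w))"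
  by (simp add: Delta_def algebra_simps)

lemma Delta_funpow_add:
  "(Delta y ^^ i) (\<lambda>x. f x + g x) = (\<lambda>x. (Delta y ^^ i) f x + (Delta y ^^ i) g x)"
  by (induction i) (simp_all add: Delta_add)

lemma Delta_funpow_scale: "(Delta y ^^ i) (\<lambda>x. c * f x) = (\<lambda>x. c * (Delta y ^^ i) f x)"
  by (induction i) (simp_all add: Delta_scale)

lemma Delta_funpow_shift: "(Delta y ^^ i) (\<lambda>x. f (x + w)) = (\<lambda>x. (Delta y ^^ i) f (x + w))"
  by (induction i) (simp_all add: Delta_shift)

lemma Delta_funpow_eq_zero:
  assumes "(Delta y ^^ m) f = (\<lambda>_. 0)" "m \<le> i"
  shows "(Delta y ^^ i) f = (\<lambda>_. 0)"
proof -
  have "(Delta y ^^ i) f = (Delta y ^^ (i - m)) ((Delta y ^^ m) f)"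
    using assms(2) by (metis comp_apply funpow_add le_add_diff_inverse2)
  then show ?thesis by (simp add: assms(1))
qed

lemma Deltas_Cons: "Deltas (y # ys) f = Delta y (Deltas ys f)"
  by (simp add: Deltas_def)

lemma Deltas_append: "Deltas (xs @ ys) f = Deltas xs (Deltas ys f)"
  by (simp add: Deltas_def)

lemma Deltas_Delta: "Deltas ys (Delta y f) = Delta y (Deltas ys f)"
  by (induction ys) (simp_all add: Deltas_def, metis Delta_commute)

lemma Deltas_replicate: "Deltas (replicate j y) f = (Delta y ^^ j) f"
  by (induction j) (simp_all add: Deltas_def)

section \<open>Polarization\<close>

text \<open>Filtration by order in the directions \<open>y\<close> and \<open>z\<close>: each of
  \<open>Delta y\<close> and \<open>Delta z\<close> lowers the level by one, and level 0 contains
  only the zero function. Terms of higher order in the differences thus lie at lower levels.\<close>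

definition Delta_filt :: "'a::ab_group_add \<Rightarrow> 'a \<Rightarrow> nat \<Rightarrow> ('a \<Rightarrow> complex) set" where
  "Delta_filt y z d = {f. \<forall>i j. d \<le> i + j \<longrightarrow> (Delta y ^^ i) ((Delta z ^^ j) f) = (\<lambda>_. 0)}"

lemma Delta_filtD:
  "f \<in> Delta_filt y z d \<Longrightarrow> d \<le> i + j \<Longrightarrow> (Delta y ^^ i) ((Delta z ^^ j) f) = (\<lambda>_. 0)"
  by (simp add: Delta_filt_def)

lemma Delta_filt_0D: "f \<in> Delta_filt y z 0 \<Longrightarrow> f = (\<lambda>_. 0)"
  using Delta_filtD[of f y z 0 0 0] by simp

lemma Delta_filt_zero: "(\<lambda>_. 0) \<in> Delta_filt y z d"
  by (simp add: Delta_filt_def)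

lemma Delta_filt_add:
  "f \<in> Delta_filt y z d \<Longrightarrow> g \<in> Delta_filt y z d \<Longrightarrow> (\<lambda>x. f x + g x) \<in> Delta_filt y z d"
  by (simp add: Delta_filt_def Delta_funpow_add)

lemma Delta_filt_scale: "f \<in> Delta_filt y z d \<Longrightarrow> (\<lambda>x. c * f x) \<in> Delta_filt y z d"
  by (simp add: Delta_filt_def Delta_funpow_scale)

lemma Delta_filt_shift: "f \<in> Delta_filt y z d \<Longrightarrow> (\<lambda>x. f (x + w)) \<in> Delta_filt y z d"
  by (simp add: Delta_filt_def Delta_funpow_shift)

lemma Delta_filt_funpow:
  assumes "f \<in> Delta_filt y z (d + p + q)"
  shows "(Delta y ^^ p) ((Delta z ^^ q) f) \<in> Delta_filt y z d"
proof -
  have "(Delta y ^^ i) ((Delta z ^^ j) ((Delta y ^^ p) ((Delta z ^^ q) f))) = (\<lambda>_. 0)"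
    if "d \<le> i + j" for i j
  proof -
    have "(Delta y ^^ i) ((Delta z ^^ j) ((Delta y ^^ p) ((Delta z ^^ q) f)))
        = (Delta y ^^ (i + p)) ((Delta z ^^ (j + q)) f)"
      by (simp add: funpow_add Delta_funpow_commute)
    then show ?thesis using that Delta_filtD[OF assms] by simp
  qed
  then show ?thesis by (simp add: Delta_filt_def)
qed

lemma Delta_filt_fst: "f \<in> Delta_filt y z (Suc d) \<Longrightarrow> Delta y f \<in> Delta_filt y z d"
  using Delta_filt_funpow[of f y z d 1 0] by simp

lemma Delta_filt_snd: "f \<in> Delta_filt y z (Suc d) \<Longrightarrow> Delta z f \<in> Delta_filt y z d"
  using Delta_filt_funpow[of f y z d 0 1] by simp

section \<open>First-order approximation of differences along \<open>y + nmult t z\<close>\<close>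

lemma nmult_0 [simp]: "nmult 0 y = 0"
  by (simp add: nmult_def)

lemma nmult_Suc [simp]: "nmult (Suc t) y = y + nmult t y"
  by (simp add: nmult_def)

lemma Delta_filt_Delta_nmult:
  assumes "f \<in> Delta_filt y z (Suc d)"
  shows "Delta (y + nmult t z) f \<in> Delta_filt y z d"
proof (induction t)
  case 0
  then show ?case using Delta_filt_fst[OF assms] by simp
next
  case (Suc t)
  \<comment> \<open>\<open>Delta (u + z)\<close> is \<open>Delta u\<close> translated by
    \<open>z\<close>, plus \<open>Delta z\<close>; every level is closed under translation.\<close>
  have "Delta (y + nmult (Suc t) z) f
      = (\<lambda>x. Delta (y + nmult t z) f (x + z) + Delta z f x)"
    by (rule ext) (simp add: Delta_apply algebra_simps)
  then show ?case
    using Delta_filt_add[OF Delta_filt_shift[OF Suc] Delta_filt_snd[OF assms]] by simp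
qed

text \<open>First-order part of \<open>Delta (y + nmult t z)\<close>. Its powers depend on
  \<open>t\<close> through an explicit polynomial.\<close>

definition Delta_lin :: "'a::ab_group_add \<Rightarrow> 'a \<Rightarrow> nat \<Rightarrow> ('a \<Rightarrow> complex) \<Rightarrow> 'a \<Rightarrow> complex" where
  "Delta_lin y z t f = (\<lambda>x. Delta y f x + of_nat t * Delta z f x)"

lemma Delta_filt_Delta_lin:
  "f \<in> Delta_filt y z (Suc d) \<Longrightarrow> Delta_lin y z t f \<in> Delta_filt y z d"
  unfolding Delta_lin_def
  by (intro Delta_filt_add Delta_filt_scale Delta_filt_fst Delta_filt_snd)

lemma Delta_filt_Delta_lin_funpow:
  "f \<in> Delta_filt y z (d + r) \<Longrightarrow> (Delta_lin y z t ^^ r) f \<in> Delta_filt y z d"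
proof (induction r arbitrary: d)
  case (Suc r)
  then show ?case using Delta_filt_Delta_lin[OF Suc.IH[of "Suc d"]] by simp
qed simp

text \<open>Passing from \<open>t\<close> to \<open>Suc t\<close> adds to the error the second-order
  difference \<open>Delta (y + nmult t z) (Delta z f)\<close>, which costs two levels.\<close>

lemma Delta_filt_linearize:
  assumes "f \<in> Delta_filt y z (Suc (Suc d))"
  shows "(\<lambda>x. Delta (y + nmult t z) f x - Delta_lin y z t f x) \<in> Delta_filt y z d"
proof (induction t)
  case 0
  then show ?case by (simp add: Delta_lin_def Delta_filt_zero)
next
  case (Suc t)
  have "(\<lambda>x. Delta (y + nmult (Suc t) z) f x - Delta_lin y z (Suc t) f x)
     = (\<lambda>x. (Delta (y + nmult t z) f x - Delta_lin y z t f x)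
          + Delta (y + nmult t z) (Delta z f) x)"
    by (rule ext) (simp add: Delta_apply Delta_lin_def algebra_simps)
  then show ?case
    using Delta_filt_add[OF Suc Delta_filt_Delta_nmult[OF Delta_filt_snd[OF assms]]] by simp
qed

text \<open>Telescoping: with \<open>W\<close> for the difference and \<open>L\<close> for its
  first-order part, \<open>W^(r+1) - L^(r+1) = W (W^r - L^r) + (W - L) L^r\<close>, and each summand
  lies one level below what the powers alone would give.\<close>

lemma Delta_filt_linearize_funpow:
  "f \<in> Delta_filt y z (Suc (d + r)) \<Longrightarrow>
   (\<lambda>x. (Delta (y + nmult t z) ^^ r) f x - (Delta_lin y z t ^^ r) f x) \<in> Delta_filt y z d"
proof (induction r arbitrary: d)
  case 0
  then show ?case by (simp add: Delta_filt_zero)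
next
  case (Suc r)
  let ?w = "Delta (y + nmult t z)" and ?l = "Delta_lin y z t"
  have 1: "?w (\<lambda>x. (?w ^^ r) f x - (?l ^^ r) f x) \<in> Delta_filt y z d"
    using Suc.IH[of "Suc d"] Suc.prems by (intro Delta_filt_Delta_nmult) simp
  have "(?l ^^ r) f \<in> Delta_filt y z (Suc (Suc d))"
    using Suc.prems by (intro Delta_filt_Delta_lin_funpow) simp
  note 2 = Delta_filt_linearize[OF this]
  have "(\<lambda>x. (?w ^^ Suc r) f x - (?l ^^ Suc r) f x)
     = (\<lambda>x. ?w (\<lambda>x. (?w ^^ r) f x - (?l ^^ r) f x) x
          + (?w ((?l ^^ r) f) x - ?l ((?l ^^ r) f) x))"
    by (rule ext) (simp add: Delta_apply)
  then show ?case using Delta_filt_add[OF 1 2] by simp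
qed

text \<open>Binomial theorem for commuting operators, sorted by powers of \<open>t\<close> so that
  coefficients can be compared.\<close>

lemma Delta_lin_funpow:
  "(Delta_lin y z t ^^ r) f x =
     (\<Sum>i\<le>r. of_nat (r choose i) * (Delta y ^^ (r - i)) ((Delta z ^^ i) f) x * of_nat t ^ i)"
proof (induction r arbitrary: x)
  case (Suc r)
  define D where "D i j = (Delta y ^^ i) ((Delta z ^^ j) f)" for i j
  have Dy: "Delta y (D i j) x = D (Suc i) j x" for i j x
    by (simp add: D_def)
  have Dz: "Delta z (D i j) x = D i (Suc j) x" for i j x
    by (simp add: D_def Delta_funpow_commute1)
  have IH: "(Delta_lin y z t ^^ r) f = (\<lambda>x. \<Sum>i\<le>r. of_nat (r choose i) * D (r - i) i x * of_nat t ^ i)"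
    using Suc.IH by (simp add: D_def fun_eq_iff)
  have Dsum: "Delta u (\<lambda>x. \<Sum>i\<le>r. of_nat (r choose i) * D (r - i) i x * of_nat t ^ i) x
     = (\<Sum>i\<le>r. of_nat (r choose i) * Delta u (D (r - i) i) x * of_nat t ^ i)" for u
    by (simp add: Delta_apply sum_subtractf[symmetric] algebra_simps)
  have "(Delta_lin y z t ^^ Suc r) f x
     = (\<Sum>i\<le>r. of_nat (r choose i) * D (Suc r - i) i x * of_nat t ^ i)
     + (\<Sum>i\<le>r. of_nat (r choose i) * D (r - i) (Suc i) x * of_nat t ^ Suc i)"
    by (simp only: funpow.simps comp_def IH Delta_lin_def Dsum Dy Dz)
       (simp add: sum_distrib_left Suc_diff_le mult_ac)
  \<comment> \<open>The added summand contains \<open>r choose Suc r = 0\<close>; it makes room for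
    the index shift that prepares Pascal's rule.\<close>
  also have "(\<Sum>i\<le>r. of_nat (r choose i) * D (Suc r - i) i x * of_nat t ^ i)
     = (\<Sum>i\<le>Suc r. of_nat (r choose i) * D (Suc r - i) i x * of_nat t ^ i)"
    by simp
  also have "\<dots> = D (Suc r) 0 x
      + (\<Sum>i\<le>r. of_nat (r choose Suc i) * D (r - i) (Suc i) x * of_nat t ^ Suc i)"
    by (subst sum.atMost_Suc_shift) simp
  also have "D (Suc r) 0 x
      + (\<Sum>i\<le>r. of_nat (r choose Suc i) * D (r - i) (Suc i) x * of_nat t ^ Suc i)
      + (\<Sum>i\<le>r. of_nat (r choose i) * D (r - i) (Suc i) x * of_nat t ^ Suc i)
      = (\<Sum>i\<le>Suc r. of_nat (Suc r choose i) * D (Suc r - i) i x * of_nat t ^ i)"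
    by (subst sum.atMost_Suc_shift) (simp add: sum.distrib[symmetric] algebra_simps)
  finally show ?case by (simp add: D_def)
qed simp

section \<open>Polynomial identities on the natural numbers\<close>

lemma poly_eq_on_nat:
  fixes p q :: "'a::{idom, ring_char_0} poly"
  assumes "\<And>t. poly p (of_nat t) = poly q (of_nat t)"
  shows "p = q"
proof (rule ccontr)
  assume "p \<noteq> q"
  then have "finite {x. poly (p - q) x = 0}" by (intro poly_roots_finite) simp
  moreover have "range of_nat \<subseteq> {x. poly (p - q) x = 0}" using assms by auto
  ultimately have "finite (range (of_nat :: nat \<Rightarrow> 'a))" by (rule finite_subset[rotated])
  then show False using finite_imageD[OF _ inj_of_nat] infinite_UNIV_nat by blast
qed

text \<open>Serves to read off the coefficients in \<open>t\<close> of operator powers, and later to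
  split off one variable of a multivariate polynomial.\<close>

lemma coeffs_zero_on_nat:
  fixes c :: "nat \<Rightarrow> 'a::{idom, ring_char_0}"
  assumes "\<And>t. (\<Sum>i\<le>r. c i * of_nat t ^ i) = 0" "i \<le> r"
  shows "c i = 0"
proof -
  have "(\<Sum>i\<le>r. Polynomial.monom (c i) i) = 0"
    by (rule poly_eq_on_nat) (simp add: poly_sum poly_monom assms(1))
  then have "poly.coeff (\<Sum>i\<le>r. Polynomial.monom (c i) i) i = 0" by simp
  then show ?thesis using assms(2) by (simp add: coeff_sum)
qed

text \<open>
  On \<open>Delta_filt y z (m + 1)\<close> the operator \<open>\<Delta>\<^bsub>y + t z\<^esub>\<^sup>m\<close> agrees with
  \<open>(\<Delta>\<^sub>y + t \<Delta>\<^sub>z)\<^sup>m\<close>, a polynomial in \<open>t\<close> whose coefficients therefore all vanish.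
\<close>

lemma Delta_filt_descend:
  assumes van: "\<And>w. (Delta w ^^ m) f = (\<lambda>_. 0)"
    and f: "f \<in> Delta_filt y z (Suc d)" and "m \<le> d"
  shows "f \<in> Delta_filt y z d"
proof -
  have "(Delta y ^^ i) ((Delta z ^^ j) f) = (\<lambda>_. 0)" if "i + j = d" for i j
  proof -
    \<comment> \<open>Removing \<open>p\<close> differences in \<open>y\<close> and \<open>q\<close>
      in \<open>z\<close>, together \<open>d - m\<close>, leaves exactly \<open>m\<close> of them
      and puts \<open>g\<close> at level \<open>m + 1\<close>.\<close>
    define p where "p = min i (d - m)"
    define q where "q = d - m - p"
    have pq: "p \<le> i" "q \<le> j" "p + q + m = d"
      using that \<open>m \<le> d\<close> by (auto simp: p_def q_def)
    define g where "g = (Delta y ^^ p) ((Delta z ^^ q) f)"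
    have g: "g \<in> Delta_filt y z (Suc (0 + m))"
      unfolding g_def using f pq(3) by (intro Delta_filt_funpow) (simp add: add_ac)
    have gvan: "(Delta w ^^ m) g = (\<lambda>_. 0)" for w
      by (simp add: g_def Delta_funpow_commute[where y = w and i = m] van)
    \<comment> \<open>The linearization error of the \<open>m\<close>-th power lies at level 0,
      hence is the zero function.\<close>
    have lin: "(Delta_lin y z t ^^ m) g x = 0" for t x
      using Delta_filt_0D[OF Delta_filt_linearize_funpow[OF g, of t]] gvan
      by (simp add: fun_eq_iff)
    show ?thesis
    proof
      fix x
      \<comment> \<open>Since \<open>m - (j - q) = i - p\<close>, the coefficient of
        \<open>t ^ (j - q)\<close> contains exactly the differences still missing from
        \<open>g\<close>; its binomial factor is nonzero because
        \<open>j - q \<le> m\<close>.\<close>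
      have "of_nat (m choose (j - q)) * (Delta y ^^ (m - (j - q))) ((Delta z ^^ (j - q)) g) x = 0"
        by (rule coeffs_zero_on_nat[where r = m and i = "j - q" and c = "\<lambda>i. of_nat (m choose i) *
            (Delta y ^^ (m - i)) ((Delta z ^^ i) g) x"]) (use lin pq that in \<open>auto simp: Delta_lin_funpow\<close>)
      moreover have "(Delta y ^^ (m - (j - q))) ((Delta z ^^ (j - q)) g)
          = (Delta y ^^ (m - (j - q) + p)) ((Delta z ^^ (j - q + q)) f)"
        by (simp add: g_def funpow_add Delta_funpow_commute)
      moreover have "m - (j - q) + p = i" "j - q + q = j" "j - q \<le> m" using pq that by auto
      ultimately show "(Delta y ^^ i) ((Delta z ^^ j) f) x = 0" by simp
    qed
  qed
  then show ?thesis
    using Delta_filtD[OF f] by (auto simp: Delta_filt_def) (metis le_eq_less_or_eq Suc_leI)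
qed

lemma Delta_filt_polarize:
  assumes van: "\<And>w. (Delta w ^^ m) f = (\<lambda>_. 0)"
  shows "f \<in> Delta_filt y z m"
proof -
  \<comment> \<open>Among \<open>2 * m\<close> differences in two directions, one direction occurs
    at least \<open>m\<close> times.\<close>
  have "(Delta y ^^ i) ((Delta z ^^ j) f) = (\<lambda>_. 0)" if "m + m \<le> i + j" for i j
  proof (cases "m \<le> j")
    case True
    then show ?thesis by (simp add: Delta_funpow_eq_zero[OF van])
  next
    case False
    with that have "m \<le> i" by simp
    then show ?thesis by (simp add: Delta_funpow_commute[where y = y] Delta_funpow_eq_zero[OF van])
  qed
  then have "f \<in> Delta_filt y z (m + m)" by (simp add: Delta_filt_def)
  moreover have "f \<in> Delta_filt y z (m + k) \<Longrightarrow> f \<in> Delta_filt y z m" for k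
  proof (induction k)
    case (Suc k)
    then show ?case using Delta_filt_descend[OF van, of y z "m + k"] by simp
  qed simp
  ultimately show ?thesis by blast
qed

text \<open>Polarization with exponents 1 and \<open>length ys\<close> hands the hypothesis down to
  \<open>Delta y f\<close> with one power less.\<close>

lemma Deltas_eq_zero_if_diag:
  assumes "\<And>w. (Delta w ^^ length ys) f = (\<lambda>_. 0)"
  shows "Deltas ys f = (\<lambda>_. 0)"
  using assms
proof (induction ys arbitrary: f)
  case Nil
  then show ?case by (simp add: Deltas_def)
next
  case (Cons y ys)
  have "(Delta w ^^ length ys) (Delta y f) = (\<lambda>_. 0)" for w
    using Delta_filtD[OF Delta_filt_polarize[OF Cons.prems, of y w], of 1 "length ys"]
    by (simp add: Delta_funpow_commute1)
  from Cons.IH[OF this] show ?case by (simp add: Deltas_Cons Deltas_Delta)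
qed

text \<open>The condition to which all four notions are reduced. The index counts differences:
  \<open>Suc n\<close> corresponds to degree at most \<open>n\<close>, and 0 to the zero
  function.\<close>

definition Deltas_vanish :: "nat \<Rightarrow> ('a::ab_group_add \<Rightarrow> complex) \<Rightarrow> bool" where
  "Deltas_vanish n f \<longleftrightarrow> (\<forall>ys. length ys = n \<longrightarrow> Deltas ys f = (\<lambda>_. 0))"

lemma Deltas_vanish_iff_diag: "Deltas_vanish n f \<longleftrightarrow> (\<forall>y. (Delta y ^^ n) f = (\<lambda>_. 0))"
  unfolding Deltas_vanish_def
  by (metis Deltas_eq_zero_if_diag Deltas_replicate length_replicate)

lemma Deltas_vanish_funpow:
  "Deltas_vanish (m + j) f \<Longrightarrow> Deltas_vanish m ((Delta y ^^ j) f)"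
  unfolding Deltas_vanish_def
  by (metis Deltas_append Deltas_replicate length_append length_replicate)

section \<open>Newton interpolation\<close>

text \<open>Translation by \<open>y\<close> is the identity plus \<open>Delta y\<close>, so
  translation by \<open>nmult t y\<close> has a binomial expansion, which the hypothesis cuts off
  after order \<open>n\<close>.\<close>

lemma newton:
  assumes "(Delta y ^^ Suc n) f = (\<lambda>_. 0)"
  shows "f (x + nmult t y) = (\<Sum>j\<le>n. of_nat (t choose j) * (Delta y ^^ j) f x)"
proof (induction t arbitrary: x)
  case 0
  show ?case by (simp add: sum.atMost_shift)
next
  case (Suc t)
  have "f (x + nmult (Suc t) y) = f (x + y + nmult t y)" by (simp add: add.assoc)
  also have "\<dots> = (\<Sum>j\<le>n. of_nat (t choose j) * (Delta y ^^ j) f (x + y))" by (rule Suc)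
  also have "\<dots> = (\<Sum>j\<le>n. of_nat (t choose j) * (Delta y ^^ j) f x)
      + (\<Sum>j\<le>n. of_nat (t choose j) * (Delta y ^^ Suc j) f x)"
    by (simp add: Delta_apply sum.distrib[symmetric] algebra_simps)
  \<comment> \<open>The new top term vanishes by the hypothesis on \<open>f\<close>, whatever
    \<open>t\<close> is; it aligns the two sums for Pascal's rule.\<close>
  also have "(\<Sum>j\<le>n. of_nat (t choose j) * (Delta y ^^ j) f x)
      = (\<Sum>j\<le>Suc n. of_nat (t choose j) * (Delta y ^^ j) f x)"
    using assms by simp
  also have "\<dots> = f x + (\<Sum>j\<le>n. of_nat (t choose Suc j) * (Delta y ^^ Suc j) f x)"
    by (subst sum.atMost_Suc_shift) simp
  also have "\<dots> + (\<Sum>j\<le>n. of_nat (t choose j) * (Delta y ^^ Suc j) f x)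
     = (\<Sum>j\<le>Suc n. of_nat (Suc t choose j) * (Delta y ^^ j) f x)"
    by (subst sum.atMost_Suc_shift) (simp add: sum.distrib[symmetric] algebra_simps)
  also have "\<dots> = (\<Sum>j\<le>n. of_nat (Suc t choose j) * (Delta y ^^ j) f x)"
    using assms by simp
  finally show ?case .
qed

section \<open>Polynomial functions of several variables\<close>

lemma mpoly_eval_superset:
  assumes "finite S" "Poly_Mapping.keys p \<subseteq> S"
  shows "mpoly_eval p z = (\<Sum>m\<in>S. Poly_Mapping.lookup p m *
    (\<Prod>i\<in>Poly_Mapping.keys m. z i ^ Poly_Mapping.lookup m i))"
  unfolding mpoly_eval_def
  by (rule sum.mono_neutral_left) (use assms in \<open>auto simp: in_keys_iff\<close>)

lemma mpoly_eval_add: "mpoly_eval (p + q) z = mpoly_eval p z + mpoly_eval q z"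
  by (simp add: mpoly_eval_superset[of "Poly_Mapping.keys p \<union> Poly_Mapping.keys q"]
      Poly_Mapping.keys_add lookup_add sum.distrib distrib_right)

text \<open>Over a fixed range of variables, unlike over individual supports, monomials multiply by
  adding exponents factor by factor.\<close>

lemma prod_monom_lessThan:
  assumes "Poly_Mapping.keys m \<subseteq> {..<k::nat}"
  shows "(\<Prod>i\<in>Poly_Mapping.keys m. z i ^ Poly_Mapping.lookup m i)
    = (\<Prod>i<k. z i ^ Poly_Mapping.lookup m i :: 'b::comm_semiring_1)"
  by (rule prod.mono_neutral_left) (use assms in \<open>auto simp: in_keys_iff\<close>)

lemma monom_deg_lessThan:
  assumes "Poly_Mapping.keys m \<subseteq> {..<k}"
  shows "monom_deg m = (\<Sum>i<k. Poly_Mapping.lookup m i)"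
  unfolding monom_deg_def
  by (rule sum.mono_neutral_left) (use assms in \<open>auto simp: in_keys_iff\<close>)

lemma mpoly_eval_single:
  assumes "Poly_Mapping.keys m \<subseteq> {..<k}"
  shows "mpoly_eval (Poly_Mapping.single m c) z = c * (\<Prod>i<k. z i ^ Poly_Mapping.lookup m i)"
  by (subst mpoly_eval_superset[of "{m}"])
     (use assms in \<open>auto simp: prod_monom_lessThan split: if_splits\<close>)

lemma total_degree_le_iff:
  "total_degree p \<le> n \<longleftrightarrow> (\<forall>m\<in>Poly_Mapping.keys p. monom_deg m \<le> n)"
  by (auto simp: total_degree_def)

lemma mpoly_fun_deg_le_zero: "mpoly_fun_deg_le k n (\<lambda>_. 0)"
  unfolding mpoly_fun_deg_le_def
  by (rule exI[of _ 0]) (simp add: mpoly_in_def total_degree_le_iff mpoly_eval_def)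

lemma mpoly_fun_deg_le_mono:
  "mpoly_fun_deg_le k n f \<Longrightarrow> k \<le> k' \<Longrightarrow> n \<le> n' \<Longrightarrow> mpoly_fun_deg_le k' n' f"
  unfolding mpoly_fun_deg_le_def mpoly_in_def by fastforce

lemma mpoly_fun_deg_le_add:
  assumes "mpoly_fun_deg_le k n f" "mpoly_fun_deg_le k n g"
  shows "mpoly_fun_deg_le k n (\<lambda>t. f t + g t)"
proof -
  obtain p q where
    "mpoly_in k p" "total_degree p \<le> n" "\<forall>t. f t = mpoly_eval p (\<lambda>i. of_nat (t i))"
    "mpoly_in k q" "total_degree q \<le> n" "\<forall>t. g t = mpoly_eval q (\<lambda>i. of_nat (t i))"
    using assms by (auto simp: mpoly_fun_deg_le_def)
  then show ?thesis
    unfolding mpoly_fun_deg_le_def mpoly_in_def total_degree_le_iff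
    by (intro exI[of _ "p + q"])
       (use Poly_Mapping.keys_add[of p q] in \<open>fastforce simp: mpoly_eval_add\<close>)
qed

lemma mpoly_fun_deg_le_sum:
  assumes "\<And>a. a \<in> A \<Longrightarrow> mpoly_fun_deg_le k n (f a)"
  shows "mpoly_fun_deg_le k n (\<lambda>t. \<Sum>a\<in>A. f a t)"
  using assms
  by (induction A rule: infinite_finite_induct)
     (simp_all add: mpoly_fun_deg_le_zero mpoly_fun_deg_le_add)

lemma mpoly_fun_deg_le_monom:
  assumes "Poly_Mapping.keys m \<subseteq> {..<k}" "monom_deg m \<le> n"
  shows "mpoly_fun_deg_le k n (\<lambda>t. c * (\<Prod>i<k. of_nat (t i) ^ Poly_Mapping.lookup m i))"
  unfolding mpoly_fun_deg_le_def
  by (rule exI[of _ "Poly_Mapping.single m c"])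
     (use assms in \<open>auto simp: mpoly_in_def total_degree_le_iff mpoly_eval_single split: if_splits\<close>)

lemma mpoly_fun_deg_le_const: "mpoly_fun_deg_le k n (\<lambda>_. c)"
  using mpoly_fun_deg_le_monom[of 0 k n c] by (simp add: monom_deg_def)

lemma mpoly_fun_deg_le_var:
  assumes "i < k"
  shows "mpoly_fun_deg_le k 1 (\<lambda>t. of_nat (t i))"
proof -
  have "(\<Prod>j<k. of_nat (t j) ^ Poly_Mapping.lookup (Poly_Mapping.single i (1::nat)) j)
      = (of_nat (t i) :: complex)" for t :: "nat \<Rightarrow> nat"
    using assms by (subst prod.remove[of _ i]) (auto simp: lookup_single intro!: prod.neutral)
  then show ?thesis
    using mpoly_fun_deg_le_monom[of "Poly_Mapping.single i 1" k 1 1] assms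
    by (simp add: monom_deg_def)
qed

lemma mpoly_fun_deg_leE:
  assumes "mpoly_fun_deg_le k n f"
  obtains S c where "finite S" "\<And>m. m \<in> S \<Longrightarrow> Poly_Mapping.keys m \<subseteq> {..<k}"
    "\<And>m. m \<in> S \<Longrightarrow> monom_deg m \<le> n"
    "\<And>t. f t = (\<Sum>m\<in>S. c m * (\<Prod>i<k. of_nat (t i) ^ Poly_Mapping.lookup m i))"
proof -
  obtain p where p: "mpoly_in k p" "total_degree p \<le> n"
    "\<forall>t. f t = mpoly_eval p (\<lambda>i. of_nat (t i))"
    using assms by (auto simp: mpoly_fun_deg_le_def)
  show ?thesis
    by (rule that[of "Poly_Mapping.keys p" "Poly_Mapping.lookup p"])
       (use p in \<open>auto simp: mpoly_in_def total_degree_le_iff mpoly_eval_def prod_monom_lessThan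
          intro!: sum.cong\<close>)
qed

lemma mpoly_fun_deg_le_mult:
  assumes "mpoly_fun_deg_le k a f" "mpoly_fun_deg_le k b g"
  shows "mpoly_fun_deg_le k (a + b) (\<lambda>t. f t * g t)"
proof -
  obtain S c where S: "finite S" "\<And>m. m \<in> S \<Longrightarrow> Poly_Mapping.keys m \<subseteq> {..<k}"
    "\<And>m. m \<in> S \<Longrightarrow> monom_deg m \<le> a"
    "\<And>t. f t = (\<Sum>m\<in>S. c m * (\<Prod>i<k. of_nat (t i) ^ Poly_Mapping.lookup m i))"
    by (rule mpoly_fun_deg_leE[OF assms(1)]) (rule that)
  obtain S' c' where S': "finite S'" "\<And>m. m \<in> S' \<Longrightarrow> Poly_Mapping.keys m \<subseteq> {..<k}"
    "\<And>m. m \<in> S' \<Longrightarrow> monom_deg m \<le> b"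
    "\<And>t. g t = (\<Sum>m\<in>S'. c' m * (\<Prod>i<k. of_nat (t i) ^ Poly_Mapping.lookup m i))"
    by (rule mpoly_fun_deg_leE[OF assms(2)]) (rule that)
  \<comment> \<open>Different pairs may share the exponent \<open>m + m'\<close>; closure under sums
    makes it unnecessary to collect like terms.\<close>
  have eq: "f t * g t = (\<Sum>m\<in>S. \<Sum>m'\<in>S'.
      c m * c' m' * (\<Prod>i<k. of_nat (t i) ^ Poly_Mapping.lookup (m + m') i))" for t
    unfolding S(4) S'(4) sum_product
    by (intro sum.cong refl) (simp add: lookup_add power_add prod.distrib mult_ac)
  have "mpoly_fun_deg_le k (a + b)
      (\<lambda>t. c m * c' m' * (\<Prod>i<k. of_nat (t i) ^ Poly_Mapping.lookup (m + m') i))"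
    if "m \<in> S" "m' \<in> S'" for m m'
  proof (rule mpoly_fun_deg_le_monom)
    show keys: "Poly_Mapping.keys (m + m') \<subseteq> {..<k}"
      using Poly_Mapping.keys_add[of m m'] S(2)[OF that(1)] S'(2)[OF that(2)] by blast
    show "monom_deg (m + m') \<le> a + b"
      using S(2,3)[OF that(1)] S'(2,3)[OF that(2)]
      by (simp add: monom_deg_lessThan[OF keys] monom_deg_lessThan lookup_add sum.distrib add_mono)
  qed
  then show ?thesis unfolding eq by (intro mpoly_fun_deg_le_sum)
qed

text \<open>Each step of the recursion for binomial coefficients multiplies by one linear factor.
  Over the complex numbers the recursion also holds for \<open>s < j\<close>, where both sides are
  0.\<close>

lemma mpoly_fun_deg_le_choose:
  assumes "i < k"
  shows "mpoly_fun_deg_le k j (\<lambda>t. of_nat (t i choose j))"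
proof (induction j)
  case 0
  then show ?case by (simp add: mpoly_fun_deg_le_const)
next
  case (Suc j)
  have eq: "of_nat (s choose Suc j)
      = of_nat (s choose j) * ((of_nat s + - of_nat j) * (1 / of_nat (Suc j)) :: complex)" for s
    using gbinomial_mult_1[of "of_nat s :: complex" j]
    by (simp add: binomial_gbinomial field_simps del: of_nat_Suc)
  \<comment> \<open>The bound \<open>1 + 0\<close> matches the product rule: a linear factor times a
    constant.\<close>
  have "mpoly_fun_deg_le k (1 + 0)
      (\<lambda>t. (of_nat (t i) + - of_nat j) * (1 / of_nat (Suc j)))"
    by (intro mpoly_fun_deg_le_mult mpoly_fun_deg_le_add mpoly_fun_deg_le_var
        mpoly_fun_deg_le_const assms)
  from mpoly_fun_deg_le_mult[OF Suc this] show ?case by (simp only: eq) simp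
qed

text \<open>Newton expansion in the last variable: the \<open>j\<close>-th binomial has degree
  \<open>j\<close>, and its coefficient, a \<open>j\<close>-fold difference of \<open>f\<close>, has
  degree at most \<open>n - j\<close> in the other variables by induction.\<close>

lemma mpoly_fun_deg_le_if_Deltas_vanish:
  assumes "Deltas_vanish (Suc n) f"
  shows "mpoly_fun_deg_le k n (\<lambda>t. f (x + (\<Sum>i<k. nmult (t i) (y i))))"
  using assms
proof (induction k arbitrary: n f)
  case 0
  then show ?case by (simp add: mpoly_fun_deg_le_const)
next
  case (Suc k)
  have newt: "f (x + (\<Sum>i<Suc k. nmult (t i) (y i))) =
      (\<Sum>j\<le>n. of_nat (t k choose j) * (Delta (y k) ^^ j) f (x + (\<Sum>i<k. nmult (t i) (y i))))" for t
    using newton[where y = "y k" and n = n and f = f and x = "x + (\<Sum>i<k. nmult (t i) (y i))" and t = "t k"] Suc.prems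
    by (simp add: Deltas_vanish_iff_diag add.assoc)
  have "mpoly_fun_deg_le (Suc k) n
      (\<lambda>t. of_nat (t k choose j) * (Delta (y k) ^^ j) f (x + (\<Sum>i<k. nmult (t i) (y i))))"
    if "j \<le> n" for j
  proof -
    have "Deltas_vanish (Suc (n - j)) ((Delta (y k) ^^ j) f)"
      using Suc.prems that by (intro Deltas_vanish_funpow) simp
    from mpoly_fun_deg_le_mono[OF Suc.IH[OF this], of "Suc k" "n - j"]
    have "mpoly_fun_deg_le (Suc k) (j + (n - j))
      (\<lambda>t. of_nat (t k choose j) * (Delta (y k) ^^ j) f (x + (\<Sum>i<k. nmult (t i) (y i))))"
      by (intro mpoly_fun_deg_le_mult mpoly_fun_deg_le_choose) auto
    then show ?thesis using that by simp
  qed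
  then show ?case unfolding newt by (intro mpoly_fun_deg_le_sum) auto
qed

text \<open>
  Distinctness is assumed for the exponents truncated to the first \<open>k\<close> entries, not via
  \<open>keys m \<subseteq> {..<k}\<close>, because the induction on \<open>k\<close> cannot preserve the latter.
\<close>

lemma monomials_independent:
  fixes c :: "(nat \<Rightarrow>\<^sub>0 nat) \<Rightarrow> complex"
  assumes "finite S"
    and "\<And>m m'. m \<in> S \<Longrightarrow> m' \<in> S \<Longrightarrow>
      (\<And>i. i < k \<Longrightarrow> Poly_Mapping.lookup m i = Poly_Mapping.lookup m' i) \<Longrightarrow> m = m'"
    and "\<And>t :: nat \<Rightarrow> nat. (\<Sum>m\<in>S. c m * (\<Prod>i<k. of_nat (t i) ^ Poly_Mapping.lookup m i)) = 0"
    and "m \<in> S"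
  shows "c m = 0"
  using assms
proof (induction k arbitrary: S m)
  case 0
  \<comment> \<open>With no coordinates left to compare, all elements of \<open>S\<close> coincide
    and the vanishing sum is \<open>c m\<close> itself.\<close>
  then have "S = {m}" by blast
  with "0.prems"(3) show ?case by simp
next
  case (Suc k)
  let ?L = "Poly_Mapping.lookup"
  let ?T = "\<lambda>j. {m \<in> S. ?L m k = j}"
  define r where "r = Max ((\<lambda>m. ?L m k) ` S)"
  have le: "?L m k \<le> r" if "m \<in> S" for m
    using Suc.prems(1) that by (simp add: r_def)
  show ?case
  proof (rule Suc.IH[of "?T (?L m k)"])
    show "finite (?T (?L m k))" "m \<in> ?T (?L m k)" using Suc.prems by auto
    show "m1 = m2" if "m1 \<in> ?T (?L m k)" "m2 \<in> ?T (?L m k)"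
      "\<And>i. i < k \<Longrightarrow> ?L m1 i = ?L m2 i" for m1 m2
      by (rule Suc.prems(2)) (use that in \<open>auto simp: less_Suc_eq\<close>)
    show "(\<Sum>m'\<in>?T (?L m k). c m' * (\<Prod>i<k. of_nat (t i) ^ ?L m' i)) = 0"
      for t :: "nat \<Rightarrow> nat"
    \<comment> \<open>With the first \<open>k\<close> variables fixed, the whole sum is a polynomial
      in the value \<open>s\<close> of the last one; its coefficients are the sums over the fibres
      \<open>?T j\<close>.\<close>
    proof (rule coeffs_zero_on_nat[where r = r and i = "?L m k"
          and c = "\<lambda>j. \<Sum>m'\<in>?T j. c m' * (\<Prod>i<k. of_nat (t i) ^ ?L m' i)"])
      fix s :: nat
      have "(\<Sum>j\<le>r. (\<Sum>m'\<in>?T j. c m' * (\<Prod>i<k. of_nat (t i) ^ ?L m' i)) * of_nat s ^ j)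
        = (\<Sum>j\<le>r. \<Sum>m'\<in>?T j. c m' * (\<Prod>i<Suc k. of_nat ((t(k := s)) i) ^ ?L m' i))"
        by (intro sum.cong refl) (simp add: sum_distrib_left sum_distrib_right mult_ac)
      also have "\<dots> = (\<Sum>m'\<in>S. c m' * (\<Prod>i<Suc k. of_nat ((t(k := s)) i) ^ ?L m' i))"
        using Suc.prems(1) le by (intro sum.group) auto
      also have "\<dots> = 0" by (rule Suc.prems(3))
      finally show "(\<Sum>j\<le>r. (\<Sum>m'\<in>?T j. c m' * (\<Prod>i<k. of_nat (t i) ^ ?L m' i)) * of_nat s ^ j) = 0" .
    qed (use le Suc.prems(4) in auto)
  qed
qed

text \<open>Independence of monomials applies to the coefficient differences on the joint support:
  variables from \<open>k\<close> on do not occur, so truncation keeps exponents distinct.\<close>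

lemma mpoly_eq_on_nat:
  assumes p: "mpoly_in k p" and q: "mpoly_in k q"
    and eq: "\<And>t :: nat \<Rightarrow> nat. mpoly_eval p (\<lambda>i. of_nat (t i)) = mpoly_eval q (\<lambda>i. of_nat (t i))"
  shows "p = q"
proof (rule poly_mapping_eqI)
  fix m
  let ?L = "Poly_Mapping.lookup" and ?S = "Poly_Mapping.keys p \<union> Poly_Mapping.keys q"
  have keys: "Poly_Mapping.keys m \<subseteq> {..<k}" if "m \<in> ?S" for m
    using that p q by (auto simp: mpoly_in_def)
  show "?L p m = ?L q m"
  proof (cases "m \<in> ?S")
    case True
    have "?L p m - ?L q m = 0"
    proof (rule monomials_independent[of ?S k "\<lambda>m. ?L p m - ?L q m"])
      show "m1 = m2" if m: "m1 \<in> ?S" "m2 \<in> ?S" "\<And>i. i < k \<Longrightarrow> ?L m1 i = ?L m2 i" for m1 m2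
      proof (rule poly_mapping_eqI)
        fix i
        show "?L m1 i = ?L m2 i"
        proof (cases "i < k")
          case False
          then have "i \<notin> Poly_Mapping.keys m1" "i \<notin> Poly_Mapping.keys m2"
            using keys[OF m(1)] keys[OF m(2)] by auto
          then show ?thesis by (simp add: in_keys_iff)
        qed (rule m(3))
      qed
      fix t :: "nat \<Rightarrow> nat"
      have "(\<Sum>m\<in>?S. (?L p m - ?L q m) * (\<Prod>i<k. of_nat (t i) ^ ?L m i))
          = (\<Sum>m\<in>?S. (?L p m - ?L q m) * (\<Prod>i\<in>Poly_Mapping.keys m. of_nat (t i) ^ ?L m i))"
        by (intro sum.cong refl) (simp add: prod_monom_lessThan[OF keys])
      also have "\<dots> = mpoly_eval p (\<lambda>i. of_nat (t i)) - mpoly_eval q (\<lambda>i. of_nat (t i))"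
        by (simp add: mpoly_eval_superset[of ?S] left_diff_distrib sum_subtractf)
      finally show "(\<Sum>m\<in>?S. (?L p m - ?L q m) * (\<Prod>i<k. of_nat (t i) ^ ?L m i)) = 0"
        by (simp add: eq)
    qed (use True in auto)
    then show ?thesis by simp
  qed (simp add: in_keys_iff)
qed

section \<open>Polynomial functions of one variable\<close>

text \<open>For one variable an exponent vector is just its entry at 0. The constant tuple is
  harmless, as only its value at 0 is read.\<close>

lemma poly_fun_deg_le_if_mpoly:
  assumes "mpoly_fun_deg_le 1 n f"
  shows "poly_fun_deg_le n (\<lambda>s. f (\<lambda>_. s))"
proof -
  obtain S c where S: "finite S" "\<And>m. m \<in> S \<Longrightarrow> Poly_Mapping.keys m \<subseteq> {..<1}"
    "\<And>m. m \<in> S \<Longrightarrow> monom_deg m \<le> n"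
    "\<And>t. f t = (\<Sum>m\<in>S. c m * (\<Prod>i<1. of_nat (t i) ^ Poly_Mapping.lookup m i))"
    by (rule mpoly_fun_deg_leE[OF assms]) (rule that)
  let ?p = "\<Sum>m\<in>S. Polynomial.monom (c m) (Poly_Mapping.lookup m 0)"
  have "Polynomial.degree (Polynomial.monom (c m) (Poly_Mapping.lookup m 0)) \<le> n" if "m \<in> S" for m
    using degree_monom_le[of "c m" "Poly_Mapping.lookup m 0"] S(3)[OF that]
    by (simp add: monom_deg_lessThan[OF S(2)[OF that]])
  then have "Polynomial.degree ?p \<le> n" by (intro degree_sum_le S(1))
  moreover have "f (\<lambda>_. s) = poly ?p (of_nat s)" for s
    by (simp add: S(4) poly_sum poly_monom)
  ultimately show ?thesis unfolding poly_fun_deg_le_def by blast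
qed

text \<open>Composition with \<open>[:1, 1:]\<close> keeps the leading coefficient, so each
  difference with step 1 cancels the top term.\<close>

lemma Delta_funpow_poly_eq_zero:
  "Polynomial.degree p \<le> n \<Longrightarrow> (Delta 1 ^^ Suc n) (poly p) = (\<lambda>_. 0)"
proof (induction n arbitrary: p)
  case 0
  then show ?case by (auto elim!: degree_eq_zeroE simp: Delta_def)
next
  case (Suc n)
  let ?q = "pcompose p [:1, 1:] - p"
  have "Polynomial.degree ?q \<le> Suc n"
    using Suc.prems by (intro degree_diff_le) (simp_all add: degree_pcompose)
  moreover have "poly.coeff ?q (Suc n) = 0"
  proof (cases "Polynomial.degree p = Suc n")
    case True
    then show ?thesis using lead_coeff_comp[of "[:1, 1:]" p] by (simp add: degree_pcompose)
  next
    case False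
    then show ?thesis using Suc.prems by (simp add: coeff_eq_0 degree_pcompose)
  qed
  ultimately have "Polynomial.degree ?q \<le> n"
    by (metis degree_0 eq_zero_or_degree_less less_Suc_eq_le zero_le)
  then have "(Delta 1 ^^ Suc n) (poly ?q) = (\<lambda>_. 0)" by (rule Suc.IH)
  moreover have "poly ?q = Delta 1 (poly p)"
    by (simp add: fun_eq_iff Delta_apply poly_pcompose add.commute)
  ultimately show ?case by (simp add: funpow_swap1)
qed

lemma Delta_funpow_eq_zero_if_poly_fun:
  assumes "poly_fun_deg_le n (\<lambda>t. f (x + nmult t y))"
  shows "(Delta y ^^ Suc n) f x = 0"
proof -
  obtain p where p: "Polynomial.degree p \<le> n" "\<And>t. f (x + nmult t y) = poly p (of_nat t)"
    using assms by (auto simp: poly_fun_deg_le_def)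
  \<comment> \<open>Differences of \<open>f\<close> with step \<open>y\<close> along the progression
    are differences of \<open>p\<close> with step 1. Order \<open>Suc j\<close> at \<open>t\<close>
    uses order \<open>j\<close> at \<open>t\<close> and \<open>Suc t\<close>, so \<open>t\<close>
    must vary in the induction.\<close>
  have "(Delta y ^^ j) f (x + nmult t y) = (Delta 1 ^^ j) (poly p) (of_nat t)" for j t
  proof (induction j arbitrary: t)
    case (Suc j)
    then show ?case
      using Suc[of "Suc t"] by (simp add: Delta_apply add_ac)
  qed (simp add: p)
  from this[of "Suc n" 0] show ?thesis using Delta_funpow_poly_eq_zero[OF p(1)] by simp
qed

section \<open>Characterizations of the degree\<close>

lemma Deltas_vanish_if_Domar:
  assumes "\<And>x y. poly_fun_deg_le n (\<lambda>t. f (x + nmult t y))"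
  shows "Deltas_vanish (Suc n) f"
  unfolding Deltas_vanish_iff_diag
  using Delta_funpow_eq_zero_if_poly_fun[OF assms] by (simp add: fun_eq_iff)

lemma Domar_if_multi_Domar:
  fixes f :: "'a::ab_group_add \<Rightarrow> complex"
  assumes "\<And>k x (y :: nat \<Rightarrow> 'a). 0 < k \<Longrightarrow>
    mpoly_fun_deg_le k n (\<lambda>t. f (x + (\<Sum>i<k. nmult (t i) (y i))))"
  shows "poly_fun_deg_le n (\<lambda>t. f (x + nmult t y))"
  using poly_fun_deg_le_if_mpoly[OF assms[of 1 x "\<lambda>_. y"]] by simp

lemma Domar_iff_Deltas_vanish:
  "(\<forall>x y. poly_fun_deg_le n (\<lambda>t. f (x + nmult t y))) \<longleftrightarrow> Deltas_vanish (Suc n) f"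
proof (intro iffI allI)
  show "Deltas_vanish (Suc n) f" if "\<forall>x y. poly_fun_deg_le n (\<lambda>t. f (x + nmult t y))"
    using that by (intro Deltas_vanish_if_Domar) simp
  show "poly_fun_deg_le n (\<lambda>t. f (x + nmult t y))" if "Deltas_vanish (Suc n) f" for x y
    by (rule Domar_if_multi_Domar) (rule mpoly_fun_deg_le_if_Deltas_vanish[OF that])
qed

lemma multi_Domar_iff_Deltas_vanish:
  fixes f :: "'a::ab_group_add \<Rightarrow> complex"
  shows "(\<forall>k>0. \<forall>x. \<forall>y :: nat \<Rightarrow> 'a.
      mpoly_fun_deg_le k n (\<lambda>t. f (x + (\<Sum>i<k. nmult (t i) (y i))))) \<longleftrightarrow> Deltas_vanish (Suc n) f" (is "?L \<longleftrightarrow> _")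
proof
  show "Deltas_vanish (Suc n) f" if ?L
    by (rule Deltas_vanish_if_Domar, rule Domar_if_multi_Domar) (simp add: that)
  show ?L if "Deltas_vanish (Suc n) f"
    by (intro allI impI) (rule mpoly_fun_deg_le_if_Deltas_vanish[OF that])
qed

section \<open>Exact degree versus degree bounds\<close>

lemma Deltas_vanish_0: "Deltas_vanish 0 f \<longleftrightarrow> f = (\<lambda>_. 0)"
  by (simp add: Deltas_vanish_def Deltas_def)

text \<open>Without a nonzero term of degree \<open>n\<close>, the representing polynomial meets the
  bound one lower. Below degree 0 only the zero function remains.\<close>

lemma poly_fun_deg_drop:
  assumes "poly_fun_deg_le n f" "\<not> poly_fun_deg n f"
  shows "n = 0 \<and> f = (\<lambda>_. 0) \<or> (\<exists>n'. n = Suc n' \<and> poly_fun_deg_le n' f)"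
proof -
  obtain p where p: "Polynomial.degree p \<le> n" "\<And>t. f t = poly p (of_nat t)"
    using assms(1) by (auto simp: poly_fun_deg_le_def)
  with assms(2) have "p = 0 \<or> Polynomial.degree p \<noteq> n" by (auto simp: poly_fun_deg_def)
  with p show ?thesis by (cases n) (force simp: poly_fun_deg_le_def fun_eq_iff)+
qed

lemma mpoly_fun_deg_drop:
  assumes "mpoly_fun_deg_le k n f" "\<not> mpoly_fun_deg k n f"
  shows "n = 0 \<and> f = (\<lambda>_. 0) \<or> (\<exists>n'. n = Suc n' \<and> mpoly_fun_deg_le k n' f)"
proof -
  obtain p where p: "mpoly_in k p" "total_degree p \<le> n"
    "\<And>t. f t = mpoly_eval p (\<lambda>i. of_nat (t i))"
    using assms(1) by (auto simp: mpoly_fun_deg_le_def)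
  with assms(2) have cs: "p = 0 \<or> total_degree p \<noteq> n" by (auto simp: mpoly_fun_deg_def)
  have 0: "f = (\<lambda>_. 0)" if "p = 0" using p(3) that by (auto simp: mpoly_eval_def)
  show ?thesis
  proof (cases n)
    case 0
    then show ?thesis using cs p(2) \<open>p = 0 \<Longrightarrow> f = (\<lambda>_. 0)\<close> by auto
  next
    case (Suc n')
    have "mpoly_fun_deg_le k n' f"
    proof (cases "p = 0")
      case True
      then show ?thesis using 0 mpoly_fun_deg_le_zero by simp
    next
      case False
      then show ?thesis using cs p Suc unfolding mpoly_fun_deg_le_def by (intro exI[of _ p]) auto
    qed
    with Suc show ?thesis by simp
  qed
qed

text \<open>The representing polynomial is unique, so a function cannot have two degrees.\<close>

lemma not_poly_fun_deg_Suc: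
  assumes "poly_fun_deg_le n f"
  shows "\<not> poly_fun_deg (Suc n) f"
proof
  assume "poly_fun_deg (Suc n) f"
  with assms obtain p q :: "complex poly" where "Polynomial.degree p \<le> n" "Polynomial.degree q = Suc n"
    "\<And>t. poly p (of_nat t) = poly q (of_nat t)"
    unfolding poly_fun_deg_def poly_fun_deg_le_def by metis
  with poly_eq_on_nat[of p q] show False by simp
qed

lemma not_mpoly_fun_deg_Suc:
  assumes "mpoly_fun_deg_le k n f"
  shows "\<not> mpoly_fun_deg k (Suc n) f"
proof
  assume "mpoly_fun_deg k (Suc n) f"
  with assms obtain p q where "mpoly_in k p" "mpoly_in k q"
    "total_degree p \<le> n" "total_degree q = Suc n"
    "\<And>t :: nat \<Rightarrow> nat. mpoly_eval p (\<lambda>i. of_nat (t i)) = mpoly_eval q (\<lambda>i. of_nat (t i))"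
    unfolding mpoly_fun_deg_def mpoly_fun_deg_le_def by metis
  with mpoly_eq_on_nat[of k p q] show False by simp
qed

text \<open>Replaces the preceding bound at \<open>n = 0\<close>, where no smaller degree exists;
  uniqueness is applied against the zero polynomial.\<close>

lemma not_poly_fun_deg_0: "\<not> poly_fun_deg 0 (\<lambda>_. 0)"
proof
  assume "poly_fun_deg 0 (\<lambda>_. 0)"
  then obtain p where "p \<noteq> 0" "\<And>t :: nat. poly p (of_nat t) = (0 :: complex)"
    unfolding poly_fun_deg_def by metis
  then show False using poly_eq_on_nat[of p 0] by simp
qed

lemma not_mpoly_fun_deg_0: "\<not> mpoly_fun_deg k 0 (\<lambda>_. 0)"
proof
  assume "mpoly_fun_deg k 0 (\<lambda>_. 0)"
  then obtain p where "p \<noteq> 0" "mpoly_in k p"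
    "\<And>t :: nat \<Rightarrow> nat. mpoly_eval p (\<lambda>i. of_nat (t i)) = 0"
    unfolding mpoly_fun_deg_def by metis
  then show False using mpoly_eq_on_nat[of k p 0] by (simp add: mpoly_in_def mpoly_eval_def)
qed

section \<open>The four notions in terms of vanishing differences\<close>

lemma is_polynomial_iff: "is_polynomial n f \<longleftrightarrow> Deltas_vanish (Suc n) f \<and> \<not> Deltas_vanish n f"
  by (auto simp: is_polynomial_def Deltas_vanish_def)

lemma is_polynomial_diag_iff:
  "is_polynomial_diag n f \<longleftrightarrow> Deltas_vanish (Suc n) f \<and> \<not> Deltas_vanish n f"
  by (simp add: is_polynomial_diag_def Deltas_vanish_iff_diag)

lemma is_Domar_polynomial_iff:
  "is_Domar_polynomial n f \<longleftrightarrow> Deltas_vanish (Suc n) f \<and> \<not> Deltas_vanish n f"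
proof -
  \<comment> \<open>Given the bound \<open>n\<close>, exact degree \<open>n\<close> is attained
    nowhere precisely if the next lower bound holds everywhere, or \<open>f\<close> is zero when
    \<open>n = 0\<close>.\<close>
  have "(\<exists>x y. poly_fun_deg n (\<lambda>t. f (x + nmult t y))) \<longleftrightarrow> \<not> Deltas_vanish n f"
    if V: "Deltas_vanish (Suc n) f"
  proof
    assume ex: "\<exists>x y. poly_fun_deg n (\<lambda>t. f (x + nmult t y))"
    show "\<not> Deltas_vanish n f"
    proof (cases n)
      case 0
      with ex show ?thesis by (auto simp: Deltas_vanish_0 not_poly_fun_deg_0)
    next
      case (Suc n')
      with ex show ?thesis using Domar_iff_Deltas_vanish not_poly_fun_deg_Suc by blast
    qed
  next
    assume nv: "\<not> Deltas_vanish n f"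
    show "\<exists>x y. poly_fun_deg n (\<lambda>t. f (x + nmult t y))"
    proof (rule ccontr)
      assume no: "\<not> ?thesis"
      have drop: "n = 0 \<and> (\<lambda>t. f (x + nmult t y)) = (\<lambda>_. 0) \<or>
          (\<exists>n'. n = Suc n' \<and> poly_fun_deg_le n' (\<lambda>t. f (x + nmult t y)))" for x y
        using no V by (intro poly_fun_deg_drop) (auto simp: Domar_iff_Deltas_vanish[symmetric])
      show False
      proof (cases n)
        case 0
        \<comment> \<open>Direction 0 and \<open>t = 0\<close> recover the value
          \<open>f x\<close>.\<close>
        then have "f x = 0" for x using drop[of x 0] by (auto dest: fun_cong[of _ _ 0])
        with nv 0 show False by (auto simp: Deltas_vanish_0)
      next
        case (Suc n')
        then have "poly_fun_deg_le n' (\<lambda>t. f (x + nmult t y))" for x y using drop[of x y] by simp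
        with nv Suc show False using Deltas_vanish_if_Domar by blast
      qed
    qed
  qed
  then show ?thesis unfolding is_Domar_polynomial_def Domar_iff_Deltas_vanish by blast
qed

lemma is_multi_Domar_polynomial_iff:
  fixes f :: "'a::ab_group_add \<Rightarrow> complex"
  shows "is_multi_Domar_polynomial n f \<longleftrightarrow> Deltas_vanish (Suc n) f \<and> \<not> Deltas_vanish n f"
proof -
  let ?F = "\<lambda>k x (y :: nat \<Rightarrow> 'a) t. f (x + (\<Sum>i<k. nmult (t i) (y i)))"
  have "(\<exists>k>0. \<exists>x y. mpoly_fun_deg k n (?F k x y)) \<longleftrightarrow> \<not> Deltas_vanish n f"
    if V: "Deltas_vanish (Suc n) f"
  proof
    assume ex: "\<exists>k>0. \<exists>x y. mpoly_fun_deg k n (?F k x y)"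
    show "\<not> Deltas_vanish n f"
    proof (cases n)
      case 0
      with ex show ?thesis by (auto simp: Deltas_vanish_0 not_mpoly_fun_deg_0)
    next
      case (Suc n')
      with ex show ?thesis
        using mpoly_fun_deg_le_if_Deltas_vanish not_mpoly_fun_deg_Suc by blast
    qed
  next
    assume nv: "\<not> Deltas_vanish n f"
    show "\<exists>k>0. \<exists>x y. mpoly_fun_deg k n (?F k x y)"
    proof (rule ccontr)
      assume no: "\<not> ?thesis"
      have drop: "n = 0 \<and> ?F k x y = (\<lambda>_. 0) \<or>
          (\<exists>n'. n = Suc n' \<and> mpoly_fun_deg_le k n' (?F k x y))" if "k > 0" for k x y
      proof (rule mpoly_fun_deg_drop)
        show "\<not> mpoly_fun_deg k n (?F k x y)"
        proof
          assume "mpoly_fun_deg k n (?F k x y)"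
          with that have "\<exists>k>0. \<exists>x y. mpoly_fun_deg k n (?F k x y)"
            by (intro exI[of _ k] conjI exI[of _ x] exI[of _ y])
          with no show False ..
        qed
      qed (rule mpoly_fun_deg_le_if_Deltas_vanish[OF V])
      show False
      proof (cases n)
        case 0
        \<comment> \<open>One variable with direction 0, evaluated at the zero tuple, recovers
          \<open>f x\<close>.\<close>
        then have "f x = 0" for x
          using drop[of 1 x "\<lambda>_. 0"] by (auto dest: fun_cong[of _ _ "\<lambda>_. 0"])
        with nv 0 show False by (auto simp: Deltas_vanish_0)
      next
        case (Suc n')
        then have "mpoly_fun_deg_le k n' (?F k x y)" if "k > 0" for k x y
          using drop[OF that] by simp
        with nv Suc show False using multi_Domar_iff_Deltas_vanish[of n' f] by blast
      qed
    qed
  qed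
  then show ?thesis
    unfolding is_multi_Domar_polynomial_def multi_Domar_iff_Deltas_vanish by blast
qed

theorem theorem3p4:
  fixes \<phi> :: "'a::{topological_ab_group_add, t2_space} \<Rightarrow> complex" and n :: nat
  assumes "locally_compact_space (euclidean :: 'a topology)"
    and "continuous_on UNIV \<phi>"
  shows "(is_polynomial n \<phi> \<longleftrightarrow> is_polynomial_diag n \<phi>) \<and>
    (is_polynomial n \<phi> \<longleftrightarrow> is_Domar_polynomial n \<phi>) \<and>
    (is_polynomial n \<phi> \<longleftrightarrow> is_multi_Domar_polynomial n \<phi>)"
  by (simp add: is_polynomial_iff is_polynomial_diag_iff is_Domar_polynomial_iff
      is_multi_Domar_polynomial_iff)

end
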